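(* Let $G$ be a good bipartite graph with a fixed choice of non-standard monomials $z_1,\dots,z_p$ (in the sense defined in the context), let $R=K[x_1,\dots,x_n]/I(G)$ and let $\mathfrak m=\langle x_1,\dots,x_n\rangle$ be the maximal ideal of $R$ generated by the classes of the variables. For every integer $k\ge 0$, the residue classes of the standard monomials of degree $k$, i.e. of the elements of $\mathcal S_k$, form a basis (indexed by $\mathcal S_k$) of the vector space $\mathfrak m^k/\mathfrak m^{k+1}$ over $K$.
   Context: $K$ is a field and $G$ is a finite simple connected bipartite graph with vertex set $V(G)=\{1,\dots,m\}$ and $n\ge 1$ edges $e_1,\dots,e_n$. A variable $x_i$ is attached to each edge $e_i$. The toric ideal $I(G)\subset K[x_1,\dots,x_n]$ is the kernel of the $K$-algebra homomorphism $K[x_1,\dots,x_n]\to K[t_1,\dots,t_m]$ sending $x_i$ to $t_at_b$ when $e_i=\{a,b\}$. It is assumed that $I(G)$ is generated by quadratic binomials. Let $p$ be the number of 4-cycles of $G$ (as subgraphs). A 4-cycle with consecutive edges $(e_a,e_b,e_c,e_d)$ gives the binomial $x_ax_c-x_bx_d\in I(G)$. For the $i$-th 4-cycle, one of its two monomials $x_ax_c$, $x_bx_d$ is chosen and called $z_i$ (the non-standard one); the other is called $w_i$; put $f_i=w_i-z_i$, so that $I(G)=\langle f_1,\dots,f_p\rangle$. The graph $G$ (with $I(G)$ generated by quadratic binomials) is called good if these choices can be made so that: (a) the monomials $z_1,\dots,z_p$ are pairwise coprime; and (b) for every $t\ge 1$ and all indices $i_1,\dots,i_t\in\{1,\dots,p\}$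 (not necessarily distinct), $\prod_{s=1}^t w_{i_s}\ne\prod_{s=1}^t z_{i_s}$ as monomials in $K[x_1,\dots,x_n]$. A choice satisfying (a) and (b) is fixed. $\mathcal M_k$ is the set of monomials of degree $k$ in $x_1,\dots,x_n$, and $\mathcal S_k=\{\mu\in\mathcal M_k : z_i\nmid \mu \text{ for all } i=1,\dots,p\}$ is the set of standard monomials of degree $k$ (divisibility is in the polynomial ring $K[x_1,\dots,x_n]$). *)

theory Defs
  imports
    "HOL-Library.Poly_Mapping"
    "HOL-Algebra.QuotRing"
    "HOL-Algebra.Ideal_Product"
    "HOL-Algebra.Algebraic_Closure_Type"
    "Jordan_Normal_Form.Missing_VectorSpace"
begin

section \<open>Polynomial rings\<close>

text \<open>
  Polynomials over \<open>'k\<close> in variables indexed by \<open>'x\<close>: finitely supported functions from exponent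
  vectors to coefficients, with the convolution product of \<^theory>\<open>HOL-Library.Poly_Mapping\<close>.
\<close>

type_synonym ('x, 'k) mpoly = "('x \<Rightarrow>\<^sub>0 nat) \<Rightarrow>\<^sub>0 'k"

abbreviation poly_ring :: "('x, 'k::field) mpoly ring" where
  "poly_ring \<equiv> ring_of_type_algebra"

definition Const :: "'k \<Rightarrow> ('x, 'k::field) mpoly" where
  "Const a = Poly_Mapping.single 0 a"

definition Var :: "'x \<Rightarrow> ('x, 'k::field) mpoly" where
  "Var i = Poly_Mapping.single (Poly_Mapping.single i 1) 1"

definition monomials :: "nat \<Rightarrow> ('x::finite, 'k::field) mpoly set" where
  "monomials k = {Poly_Mapping.single u 1 | u. (\<Sum>i\<in>UNIV. Poly_Mapping.lookup u i) = k}"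

definition quadratic_binomials :: "('x::finite, 'k::field) mpoly set" where
  "quadratic_binomials = {u - v | u v. u \<in> monomials 2 \<and> v \<in> monomials 2 \<and> u \<noteq> v}"

definition generated_by_quadratic_binomials :: "('x::finite, 'k::field) mpoly set \<Rightarrow> bool" where
  "generated_by_quadratic_binomials I \<longleftrightarrow>
     (\<exists>B \<subseteq> quadratic_binomials. I = Idl\<^bsub>poly_ring\<^esub> B)"


section \<open>Graphs\<close>

text \<open>
  A graph has the type \<open>'v\<close> as its vertex set, the type \<open>'e\<close> as the index set of its edges, and
  \<open>edge i\<close> is the set of the two ends of the \<open>i\<close>-th edge. Thus \<open>m = CARD('v)\<close> and \<open>n = CARD('e)\<close>;
  there is at least one edge because types are nonempty.
\<close>

definition simple_graph :: "('e \<Rightarrow> 'v set) \<Rightarrow> bool" where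
  "simple_graph edge \<longleftrightarrow> inj edge \<and> (\<forall>i. card (edge i) = 2)"

definition connected_graph :: "('e \<Rightarrow> 'v set) \<Rightarrow> bool" where
  "connected_graph edge \<longleftrightarrow> (\<forall>u v. (u, v) \<in> {(a, b). {a, b} \<in> range edge}\<^sup>*)"

definition bipartite_graph :: "('e \<Rightarrow> 'v set) \<Rightarrow> bool" where
  "bipartite_graph edge \<longleftrightarrow> (\<exists>A B. A \<union> B = UNIV \<and> A \<inter> B = {} \<and>
     (\<forall>i. \<exists>a\<in>A. \<exists>b\<in>B. edge i = {a, b}))"

definition consecutive_edges :: "('e \<Rightarrow> 'v set) \<Rightarrow> 'e \<Rightarrow> 'e \<Rightarrow> 'e \<Rightarrow> 'e \<Rightarrow> bool" where
  "consecutive_edges edge a b c d \<longleftrightarrow> (\<exists>v1 v2 v3 v4. distinct [v1, v2, v3, v4] \<and>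
     edge a = {v1, v2} \<and> edge b = {v2, v3} \<and> edge c = {v3, v4} \<and> edge d = {v4, v1})"

text \<open>As a subgraph, a 4-cycle is determined by its set of edges.\<close>

definition four_cycles :: "('e \<Rightarrow> 'v set) \<Rightarrow> 'e set set" where
  "four_cycles edge = {{a, b, c, d} | a b c d. consecutive_edges edge a b c d}"


section \<open>The toric ideal and the toric ring\<close>

text \<open>The \<open>'k\<close>-algebra homomorphism sending \<open>Var i\<close> to the product of the two ends of edge \<open>i\<close>.\<close>

definition toric_hom :: "('e::finite \<Rightarrow> 'v::finite set) \<Rightarrow> ('e, 'k::field) mpoly \<Rightarrow> ('v, 'k) mpoly" where
  "toric_hom edge f = (\<Sum>u\<in>Poly_Mapping.keys f. Const (Poly_Mapping.lookup f u) *
     (\<Prod>i\<in>UNIV. (\<Prod>v\<in>edge i. Var v) ^ Poly_Mapping.lookup u i))"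

definition toric_ideal :: "('e::finite \<Rightarrow> 'v::finite set) \<Rightarrow> ('e, 'k::field) mpoly set" where
  "toric_ideal edge = {f. toric_hom edge f = 0}"

definition toric_ring :: "('e::finite \<Rightarrow> 'v::finite set) \<Rightarrow> ('e, 'k::field) mpoly set ring" where
  "toric_ring edge = poly_ring Quot toric_ideal edge"

definition toric_class ::
  "('e::finite \<Rightarrow> 'v::finite set) \<Rightarrow> ('e, 'k::field) mpoly \<Rightarrow> ('e, 'k) mpoly set" where
  "toric_class edge f = toric_ideal edge +>\<^bsub>poly_ring\<^esub> f"

definition toric_max :: "('e::finite \<Rightarrow> 'v::finite set) \<Rightarrow> ('e, 'k::field) mpoly set set" where
  "toric_max edge = Idl\<^bsub>toric_ring edge\<^esub> (range (\<lambda>i. toric_class edge (Var i)))"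

text \<open>Powers are taken in the monoid of ideals, so the zeroth power is the whole ring.\<close>

definition toric_max_pow ::
  "('e::finite \<Rightarrow> 'v::finite set) \<Rightarrow> nat \<Rightarrow> ('e, 'k::field) mpoly set set" where
  "toric_max_pow edge k = toric_max edge [^]\<^bsub>ideals_set (toric_ring edge)\<^esub> k"


section \<open>Good choices of non-standard monomials\<close>

text \<open>
  The two monomials of a 4-cycle \<open>C\<close> are indexed by \<open>C\<close> itself. Rotating \<open>(a, b, c, d)\<close> swaps the
  two pairs of opposite edges, so both ways of choosing \<open>z C\<close> are covered.
\<close>

definition nonstandard_choice ::
  "('e \<Rightarrow> 'v set) \<Rightarrow> ('e set \<Rightarrow> ('e, 'k::field) mpoly) \<Rightarrow> ('e set \<Rightarrow> ('e, 'k) mpoly) \<Rightarrow> bool" where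
  "nonstandard_choice edge z w \<longleftrightarrow> (\<forall>C\<in>four_cycles edge. \<exists>a b c d.
     consecutive_edges edge a b c d \<and> C = {a, b, c, d} \<and>
     z C = Var a * Var c \<and> w C = Var b * Var d)"

definition good_choice ::
  "('e \<Rightarrow> 'v set) \<Rightarrow> ('e set \<Rightarrow> ('e, 'k::field) mpoly) \<Rightarrow> ('e set \<Rightarrow> ('e, 'k) mpoly) \<Rightarrow> bool" where
  "good_choice edge z w \<longleftrightarrow> nonstandard_choice edge z w \<and>
     (\<forall>C\<in>four_cycles edge. \<forall>D\<in>four_cycles edge. C \<noteq> D \<longrightarrow>
        (\<forall>g. g dvd z C \<longrightarrow> g dvd z D \<longrightarrow> g dvd 1)) \<and>
     (\<forall>t\<ge>1. \<forall>i::nat \<Rightarrow> 'e set. (\<forall>s\<in>{1..t}. i s \<in> four_cycles edge) \<longrightarrow>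
        (\<Prod>s=1..t. w (i s)) \<noteq> (\<Prod>s=1..t. z (i s)))"

definition standard_monomials ::
  "('e::finite \<Rightarrow> 'v set) \<Rightarrow> ('e set \<Rightarrow> ('e, 'k::field) mpoly) \<Rightarrow> nat \<Rightarrow> ('e, 'k) mpoly set" where
  "standard_monomials edge z k = {\<mu> \<in> monomials k. \<forall>C\<in>four_cycles edge. \<not> z C dvd \<mu>}"


section \<open>The vector space of a quotient of ideals\<close>

text \<open>
  For ideals \<open>N \<subseteq> M\<close> of an algebra \<open>R\<close> with structure map \<open>\<iota>\<close>: the quotient \<open>M / N\<close>, as a subspace
  of the algebra \<open>R Quot N\<close>. The fields \<^const>\<open>monoid.mult\<close> and \<^const>\<open>monoid.one\<close> of the record
  play no role in the notion of a module.
\<close>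

definition quotient_space ::
  "'a ring \<Rightarrow> ('k \<Rightarrow> 'a) \<Rightarrow> 'a set \<Rightarrow> 'a set \<Rightarrow> ('k, 'a set) module" where
  "quotient_space R \<iota> M N = \<lparr>
     carrier = (\<lambda>x. N +>\<^bsub>R\<^esub> x) ` M,
     monoid.mult = monoid.mult (R Quot N),
     one = \<one>\<^bsub>R Quot N\<^esub>,
     zero = \<zero>\<^bsub>R Quot N\<^esub>,
     add = add (R Quot N),
     module.smult = (\<lambda>a C. (N +>\<^bsub>R\<^esub> \<iota> a) \<otimes>\<^bsub>R Quot N\<^esub> C)\<rparr>"

definition toric_graded_piece ::
  "('e::finite \<Rightarrow> 'v::finite set) \<Rightarrow> nat \<Rightarrow> ('k::field, ('e, 'k) mpoly set set) module" where
  "toric_graded_piece edge k = quotient_space (toric_ring edge) (\<lambda>a. toric_class edge (Const a))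
     (toric_max_pow edge k) (toric_max_pow edge (k + 1))"

definition toric_residue ::
  "('e::finite \<Rightarrow> 'v::finite set) \<Rightarrow> nat \<Rightarrow> ('e, 'k::field) mpoly \<Rightarrow> ('e, 'k) mpoly set set" where
  "toric_residue edge k f = toric_max_pow edge (k + 1) +>\<^bsub>toric_ring edge\<^esub> toric_class edge f"

end

theory Submission
  imports Defs "HOL-Library.Confluence"
begin

text \<open>
  Orient every binomial \<open>w\<^sub>i - z\<^sub>i\<close> as the rewrite rule \<open>z\<^sub>i \<rightarrow> w\<^sub>i\<close> on monomials. A cyclic
  reduction would, after cancellation, give an equality between a product of \<open>w\<close>'s and the matching
  product of \<open>z\<close>'s; so (b) says that rewriting is acyclic, and it terminates because only finitely
  many monomials have a given degree. Because of (a), two different rules that apply to the same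
  monomial act on disjoint parts of it and commute, so rewriting is confluent, and every monomial
  has a unique normal form, which is a standard monomial of the same degree. No monomial order is
  needed.

  A quadratic binomial of \<open>I(G)\<close> is up to sign the binomial of a 4-cycle. Hence the linear extension
  of the normal form map kills \<open>I(G)\<close>, whereas every polynomial is congruent to its normal form
  modulo \<open>I(G)\<close>. As the ideal \<open>\<mm>\<^sup>k\<close> consists of the classes of the polynomials all of whose
  terms have degree at least \<open>k\<close>, comparing the terms of degree \<open>k\<close> yields both halves of the
  basis property.
\<close>

section \<open>Exponent vectors\<close>

definition mdeg :: "('x::finite \<Rightarrow>\<^sub>0 nat) \<Rightarrow> nat" where
  "mdeg u = (\<Sum>i\<in>UNIV. Poly_Mapping.lookup u i)"

lemma mdeg_zero [simp]: "mdeg 0 = 0"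
  by (simp add: mdeg_def)

lemma mdeg_add [simp]: "mdeg (u + v) = mdeg u + mdeg v"
  by (simp add: mdeg_def lookup_add sum.distrib)

lemma mdeg_single [simp]: "mdeg (Poly_Mapping.single i n) = n"
  by (simp add: mdeg_def lookup_single when_def)

lemma finite_mdeg: "finite {u :: 'x::finite \<Rightarrow>\<^sub>0 nat. mdeg u = k}"
proof (rule finite_imageD)
  have "Poly_Mapping.lookup ` {u :: 'x \<Rightarrow>\<^sub>0 nat. mdeg u = k} \<subseteq> PiE UNIV (\<lambda>_. {..k})"
    by (auto simp: mdeg_def intro!: member_le_sum)
  then show "finite (Poly_Mapping.lookup ` {u :: 'x \<Rightarrow>\<^sub>0 nat. mdeg u = k})"
    by (rule finite_subset) (auto intro: finite_PiE)
  show "inj_on Poly_Mapping.lookup {u :: 'x \<Rightarrow>\<^sub>0 nat. mdeg u = k}"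
    by (simp add: inj_on_def)
qed

lemma exponent_split:
  assumes "Poly_Mapping.lookup u i \<noteq> (0::nat)"
  obtains v where "u = Poly_Mapping.single i 1 + v"
proof
  show "u = Poly_Mapping.single i 1 + (u - Poly_Mapping.single i 1)"
    by (rule poly_mapping_eqI) (use assms in \<open>auto simp: lookup_add lookup_minus lookup_single when_def\<close>)
qed

lemma mdeg_pos_split:
  assumes "0 < mdeg u"
  obtains i v where "u = Poly_Mapping.single i 1 + v"
proof -
  obtain i where "Poly_Mapping.lookup u i \<noteq> 0"
    using assms unfolding mdeg_def by (metis less_irrefl sum.neutral)
  then show thesis
    by (rule exponent_split) (rule that)
qed

text \<open>Where \<open>b\<close> is nonzero, \<open>a\<close> vanishes, so there \<open>v\<close>
  equals \<open>b\<close> plus \<open>v'\<close>. Hence the truncated difference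
  \<open>v - b\<close> is exact and serves as \<open>t\<close>.\<close>

lemma coprime_exponents_split:
  fixes a b :: "'x \<Rightarrow>\<^sub>0 nat"
  assumes eq: "a + v = b + v'" and disj: "Poly_Mapping.keys a \<inter> Poly_Mapping.keys b = {}"
  obtains t where "v = b + t" "v' = a + t"
proof
  have lookup_eq: "Poly_Mapping.lookup a i + Poly_Mapping.lookup v i = Poly_Mapping.lookup b i + Poly_Mapping.lookup v' i" for i
    using eq by (metis lookup_add)
  have zero: "Poly_Mapping.lookup a i = 0 \<or> Poly_Mapping.lookup b i = 0" for i
    using disj by (auto simp: in_keys_iff)
  show "v = b + (v - b)"
  proof (rule poly_mapping_eqI)
    fix i
    show "Poly_Mapping.lookup v i = Poly_Mapping.lookup (b + (v - b)) i"
      using lookup_eq[of i] zero[of i] by (auto simp: lookup_add lookup_minus)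
  qed
  then have "a + (b + (v - b)) = b + v'"
    using eq by metis
  then have "b + (a + (v - b)) = b + v'"
    by (simp only: ac_simps)
  then show "v' = a + (v - b)"
    by simp
qed

section \<open>Rewriting with coprime left-hand sides\<close>

text \<open>An abstract form of a good choice, in which the rule \<open>c\<close> replaces the
  monomial with exponent \<open>Z c\<close> by the one with exponent \<open>W c\<close>. The list in
  \<open>no_cycle\<close> may repeat indices, as condition (b) demands.\<close>

locale coprime_rewriting =
  fixes S :: "'c set" and Z W :: "'c \<Rightarrow> ('x::finite \<Rightarrow>\<^sub>0 nat)"
  assumes homogeneous: "c \<in> S \<Longrightarrow> mdeg (W c) = mdeg (Z c)"
    and coprime: "c \<in> S \<Longrightarrow> d \<in> S \<Longrightarrow> c \<noteq> d \<Longrightarrow> Poly_Mapping.keys (Z c) \<inter> Poly_Mapping.keys (Z d) = {}"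
    and no_cycle: "set cs \<subseteq> S \<Longrightarrow> cs \<noteq> [] \<Longrightarrow> (\<Sum>c\<leftarrow>cs. W c) \<noteq> (\<Sum>c\<leftarrow>cs. Z c)"
begin

inductive step :: "('x \<Rightarrow>\<^sub>0 nat) \<Rightarrow> ('x \<Rightarrow>\<^sub>0 nat) \<Rightarrow> bool" where
  stepI: "c \<in> S \<Longrightarrow> step (Z c + v) (W c + v)"

lemma step_mdeg: "step u v \<Longrightarrow> mdeg v = mdeg u"
  by (auto elim!: step.cases simp: homogeneous)

lemma steps_mdeg: "step\<^sup>*\<^sup>* u v \<Longrightarrow> mdeg v = mdeg u"
  by (induction rule: rtranclp_induct) (auto dest: step_mdeg)

text \<open>One application of the rule \<open>c\<close> leads from u to v with u +
  \<open>W c\<close> = v + \<open>Z c\<close>. Along a reduction these identities telescope, and for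
  a cycle the two ends cancel, which contradicts \<open>no_cycle\<close>.\<close>

lemma steps_balance:
  assumes "step\<^sup>+\<^sup>+ u v"
  shows "\<exists>cs. set cs \<subseteq> S \<and> cs \<noteq> [] \<and> u + (\<Sum>c\<leftarrow>cs. W c) = v + (\<Sum>c\<leftarrow>cs. Z c)"
  using assms
proof (induction rule: tranclp_induct)
  case (base v)
  then obtain c t where "c \<in> S" "u = Z c + t" "v = W c + t"
    by (auto elim: step.cases)
  then show ?case
    by (intro exI[of _ "[c]"]) (auto simp: ac_simps)
next
  case (step v v')
  then obtain cs where cs: "set cs \<subseteq> S" "cs \<noteq> []" "u + (\<Sum>c\<leftarrow>cs. W c) = v + (\<Sum>c\<leftarrow>cs. Z c)"
    by blast
  obtain c t where c: "c \<in> S" "v = Z c + t" "v' = W c + t"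
    using \<open>step v v'\<close> by (auto elim: step.cases)
  have "u + (\<Sum>c\<leftarrow>c # cs. W c) = W c + (u + (\<Sum>c\<leftarrow>cs. W c))"
    by (simp add: ac_simps)
  also have "\<dots> = v' + (\<Sum>c\<leftarrow>c # cs. Z c)"
    unfolding cs(3) by (simp add: c ac_simps)
  finally show ?case
    using cs c by (intro exI[of _ "c # cs"]) auto
qed

lemma step_acyclic: "\<not> step\<^sup>+\<^sup>+ u u"
  using steps_balance[of u u] no_cycle by auto

text \<open>For distinct rules c and d, \<open>x\<close> is \<open>Z c + Z d + r\<close> by
  coprimality, and both reducts reach \<open>W c + W d + r\<close> in one step. This strong form
  gives confluence without an appeal to termination.\<close>

lemma step_strong_confluent: "strong_confluentp step"
proof
  fix x y z
  assume "step x y" "step x z"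
  then obtain c t d s where c: "c \<in> S" "x = Z c + t" "y = W c + t"
    and d: "d \<in> S" "x = Z d + s" "z = W d + s"
    by (meson step.cases)
  show "\<exists>u. step\<^sup>*\<^sup>* y u \<and> step\<^sup>=\<^sup>= z u"
  proof (cases "c = d")
    case True
    then have "y = z" using c d by simp
    then show ?thesis by auto
  next
    case False
    then obtain r where r: "t = Z d + r" "s = Z c + r"
      using coprime_exponents_split[of "Z c" t "Z d" s] coprime[of c d] c(1,2) d(1,2) by auto
    have "step y (W d + (W c + r))"
      using stepI[OF d(1), of "W c + r"] by (simp add: c r ac_simps)
    moreover have "step z (W d + (W c + r))"
      using stepI[OF c(1), of "W d + r"] by (simp add: d r ac_simps)
    ultimately show ?thesis by auto
  qed
qed

section \<open>Irreducible exponents and normal forms\<close>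

definition irreducible_exponent :: "('x \<Rightarrow>\<^sub>0 nat) \<Rightarrow> bool" where
  "irreducible_exponent u \<longleftrightarrow> (\<forall>c\<in>S. \<forall>v. u \<noteq> Z c + v)"

lemma irreducible_exponent_iff: "irreducible_exponent u \<longleftrightarrow> (\<nexists>v. step u v)"
  by (auto simp: irreducible_exponent_def intro: stepI elim!: step.cases)

lemma normal_form_exists: "\<exists>v. step\<^sup>*\<^sup>* u v \<and> irreducible_exponent v"
proof -
  \<comment> \<open>Well-founded induction needs the reversed step relation. Its restriction to the
    degree of \<open>u\<close> loses nothing, since steps preserve degree, and makes it finite, so
    that acyclicity yields well-foundedness.\<close>
  define r where "r = {(v, u'). step u' v \<and> mdeg u' = mdeg u}"
  have "r \<subseteq> {v. mdeg v = mdeg u} \<times> {v. mdeg v = mdeg u}"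
    by (auto simp: r_def step_mdeg)
  then have "finite r"
    by (rule finite_subset) (simp add: finite_mdeg)
  moreover have "acyclic r"
  proof (rule acyclicI, intro allI notI)
    fix x
    assume "(x, x) \<in> r\<^sup>+"
    moreover have "step\<^sup>+\<^sup>+ b a" if "(a, b) \<in> r\<^sup>+" for a b
      using that by (induction rule: trancl_induct) (auto simp: r_def intro: tranclp_into_tranclp2)
    ultimately show False
      using step_acyclic by blast
  qed
  ultimately have "wf r"
    by (rule finite_acyclic_wf)
  then have "mdeg u' = mdeg u \<longrightarrow> (\<exists>v. step\<^sup>*\<^sup>* u' v \<and> irreducible_exponent v)" for u'
  proof (induction u' rule: wf_induct_rule)
    case (less u')
    show ?case
    proof (cases "irreducible_exponent u'")
      case False
      then obtain v where "step u' v"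
        by (auto simp: irreducible_exponent_iff)
      then show ?thesis
        using less[of v] by (auto simp: r_def step_mdeg intro: converse_rtranclp_into_rtranclp)
    qed auto
  qed
  then show ?thesis by blast
qed

lemma normal_form_unique:
  assumes "step\<^sup>*\<^sup>* u v" "irreducible_exponent v" "step\<^sup>*\<^sup>* u v'" "irreducible_exponent v'"
  shows "v = v'"
proof -
  have irred: "x = y" if "step\<^sup>*\<^sup>* x y" "irreducible_exponent x" for x y
    using that by (auto simp: irreducible_exponent_iff elim: converse_rtranclpE)
  obtain y where "step\<^sup>*\<^sup>* v y" "step\<^sup>*\<^sup>* v' y"
    using confluentpD[OF strong_confluentp_imp_confluentp[OF step_strong_confluent]] assms by blast
  then show ?thesis
    using irred assms by blast
qed

definition nf :: "('x \<Rightarrow>\<^sub>0 nat) \<Rightarrow> ('x \<Rightarrow>\<^sub>0 nat)" where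
  "nf u = (THE v. step\<^sup>*\<^sup>* u v \<and> irreducible_exponent v)"

lemma nf: "step\<^sup>*\<^sup>* u (nf u)" "irreducible_exponent (nf u)"
proof -
  have "\<exists>!v. step\<^sup>*\<^sup>* u v \<and> irreducible_exponent v"
    using normal_form_exists[of u] normal_form_unique[of u] by auto
  from theI'[OF this] show "step\<^sup>*\<^sup>* u (nf u)" "irreducible_exponent (nf u)"
    unfolding nf_def by auto
qed

lemma nf_eqI: "step\<^sup>*\<^sup>* u v \<Longrightarrow> irreducible_exponent v \<Longrightarrow> nf u = v"
  using normal_form_unique[of u "nf u" v] nf[of u] by simp

lemma nf_irreducible: "irreducible_exponent u \<Longrightarrow> nf u = u"
  by (rule nf_eqI) auto

lemma mdeg_nf: "mdeg (nf u) = mdeg u"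
  using nf(1) steps_mdeg by blast

lemma nf_rewrite: "c \<in> S \<Longrightarrow> nf (Z c + v) = nf (W c + v)"
  by (rule nf_eqI) (auto intro: converse_rtranclp_into_rtranclp[of step, OF stepI] nf)

end

section \<open>Polynomials and monomials\<close>

lemma poly_mapping_expand: "f = (\<Sum>u\<in>Poly_Mapping.keys f. Poly_Mapping.single u (Poly_Mapping.lookup f u))"
proof (rule poly_mapping_eqI)
  fix v
  have "(\<Sum>u\<in>Poly_Mapping.keys f. Poly_Mapping.lookup (Poly_Mapping.single u (Poly_Mapping.lookup f u)) v) =
    (\<Sum>u\<in>Poly_Mapping.keys f. if u = v then Poly_Mapping.lookup f v else 0)"
    by (rule sum.cong) (auto simp: lookup_single)
  then show "Poly_Mapping.lookup f v =
    Poly_Mapping.lookup (\<Sum>u\<in>Poly_Mapping.keys f. Poly_Mapping.single u (Poly_Mapping.lookup f u)) v"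
    by (simp add: lookup_sum sum.delta in_keys_iff)
qed

text \<open>The linear extension of \<open>h\<close> from monomials to polynomials. Coefficients add
  up when \<open>h\<close> identifies exponents. For \<open>h = nf\<close> this is the normal form
  map.\<close>

definition push_exponents :: "('u \<Rightarrow> 'v) \<Rightarrow> ('u \<Rightarrow>\<^sub>0 'k::ab_group_add) \<Rightarrow> ('v \<Rightarrow>\<^sub>0 'k)" where
  "push_exponents h f = (\<Sum>u\<in>Poly_Mapping.keys f. Poly_Mapping.single (h u) (Poly_Mapping.lookup f u))"

lemma push_exponents_0 [simp]: "push_exponents h 0 = 0"
  by (simp add: push_exponents_def)

lemma push_exponents_single [simp]: "push_exponents h (Poly_Mapping.single u c) = Poly_Mapping.single (h u) c"
  by (simp add: push_exponents_def)

lemma push_exponents_add: "push_exponents h (f + g) = push_exponents h f + push_exponents h g"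
  unfolding push_exponents_def by (rule setsum_keys_plus_distrib) (simp_all add: single_add)

lemma push_exponents_diff: "push_exponents h (f - g) = push_exponents h f - push_exponents h g"
  using push_exponents_add[of h "f - g" g] by (simp add: algebra_simps)

lemma push_exponents_sum: "push_exponents h (\<Sum>i\<in>A. f i) = (\<Sum>i\<in>A. push_exponents h (f i))"
  by (induction A rule: infinite_finite_induct) (auto simp: push_exponents_add)

lemma keys_push_exponents: "Poly_Mapping.keys (push_exponents h f) \<subseteq> h ` Poly_Mapping.keys f"
proof -
  have "Poly_Mapping.keys (push_exponents h f) \<subseteq>
    (\<Union>u\<in>Poly_Mapping.keys f. Poly_Mapping.keys (Poly_Mapping.single (h u) (Poly_Mapping.lookup f u)))"
    unfolding push_exponents_def by (rule keys_sum)
  then show ?thesis by (auto split: if_splits)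
qed

text \<open>Since \<open>h\<close> need not be additive, the hypothesis speaks of all translates.
  Each term of \<open>g\<close> with exponent t then contributes equally to both products.\<close>

lemma push_exponents_mult_binomial:
  fixes g :: "('x, 'k::field) mpoly"
  assumes "\<And>t. h (t + u) = h (t + v)"
  shows "push_exponents h (g * (Poly_Mapping.single u 1 - Poly_Mapping.single v 1)) = 0"
proof -
  have "push_exponents h (g * Poly_Mapping.single u 1) = push_exponents h (g * Poly_Mapping.single v 1)"
    by (subst (1 2) poly_mapping_expand[of g])
      (simp add: sum_distrib_right mult_single push_exponents_sum assms)
  then show ?thesis
    by (simp add: right_diff_distrib push_exponents_diff)
qed

lemma single_1_dvd_single_1:
  fixes u v :: "'x \<Rightarrow>\<^sub>0 nat"
  shows "(Poly_Mapping.single u 1 :: ('x, 'k::field) mpoly) dvd Poly_Mapping.single v 1 \<longleftrightarrow> (\<exists>t. v = u + t)"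
proof
  assume "(Poly_Mapping.single u 1 :: ('x, 'k) mpoly) dvd Poly_Mapping.single v 1"
  then obtain g :: "('x, 'k) mpoly" where g: "Poly_Mapping.single v 1 = Poly_Mapping.single u 1 * g"
    by (auto elim: dvdE)
  have "Poly_Mapping.keys (Poly_Mapping.single v 1 :: ('x, 'k) mpoly) \<subseteq> {a + b |a b. a \<in> Poly_Mapping.keys (Poly_Mapping.single u 1 :: ('x, 'k) mpoly) \<and> b \<in> Poly_Mapping.keys g}"
    unfolding g by (rule keys_mult)
  then show "\<exists>t. v = u + t" by auto
next
  assume "\<exists>t. v = u + t"
  then obtain t where "v = u + t" by blast
  then have "(Poly_Mapping.single v 1 :: ('x, 'k) mpoly) = Poly_Mapping.single u 1 * Poly_Mapping.single t 1"
    by (simp add: mult_single)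
  then show "(Poly_Mapping.single u 1 :: ('x, 'k) mpoly) dvd Poly_Mapping.single v 1"
    by (rule dvdI)
qed

lemma prod_single_1:
  fixes f :: "'i \<Rightarrow> 'x \<Rightarrow>\<^sub>0 nat"
  shows "(\<Prod>i\<in>A. Poly_Mapping.single (f i) 1 :: ('x, 'k::field) mpoly) = Poly_Mapping.single (\<Sum>i\<in>A. f i) 1"
  by (induction A rule: infinite_finite_induct) (simp_all add: mult_single)

lemma Var_mult_Var:
  "(Var a * Var c :: ('x, 'k::field) mpoly) =
    Poly_Mapping.single (Poly_Mapping.single a 1 + Poly_Mapping.single c 1) 1"
  by (simp add: Var_def mult_single)

lemma Const_mult_single: "Const a * Poly_Mapping.single u b = Poly_Mapping.single u (a * b)"
  by (simp add: Const_def mult_single)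

text \<open>The k-th power of the ideal generated by the variables in the polynomial ring, described
  by its terms. Its image in the toric ring turns out to be the k-th power of the maximal
  ideal.\<close>

definition terms_ge :: "nat \<Rightarrow> ('x::finite, 'k::field) mpoly set" where
  "terms_ge k = {f. \<forall>u\<in>Poly_Mapping.keys f. k \<le> mdeg u}"

lemma terms_ge_0: "terms_ge 0 = UNIV"
  by (auto simp: terms_ge_def)

lemma zero_in_terms_ge: "0 \<in> terms_ge k"
  by (simp add: terms_ge_def)

lemma terms_ge_add: "f \<in> terms_ge k \<Longrightarrow> g \<in> terms_ge k \<Longrightarrow> f + g \<in> terms_ge k"
  using keys_add[of f g] by (auto simp: terms_ge_def)

lemma terms_ge_mult: "f \<in> terms_ge k \<Longrightarrow> g \<in> terms_ge l \<Longrightarrow> f * g \<in> terms_ge (k + l)"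
  using keys_mult[of f g] by (fastforce simp: terms_ge_def intro: add_mono)

text \<open>For preimages of ideals and similar additively closed sets, this reduces membership to
  single terms.\<close>

lemma mem_closed_under_terms:
  fixes f :: "'u \<Rightarrow>\<^sub>0 'b::comm_monoid_add"
  assumes "0 \<in> J" "\<And>f g. f \<in> J \<Longrightarrow> g \<in> J \<Longrightarrow> f + g \<in> J"
    and "\<And>u. u \<in> Poly_Mapping.keys f \<Longrightarrow> Poly_Mapping.single u (Poly_Mapping.lookup f u) \<in> J"
  shows "f \<in> J"
proof -
  have "(\<Sum>u\<in>A. Poly_Mapping.single u (Poly_Mapping.lookup f u)) \<in> J" if "finite A" "A \<subseteq> Poly_Mapping.keys f" for A
    using that by (induction A rule: finite_induct) (auto intro: assms)
  then show ?thesis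
    using poly_mapping_expand[of f] by (metis finite_keys order_refl)
qed

lemma monomials_eq: "monomials k = (\<lambda>u. Poly_Mapping.single u 1) ` {u. mdeg u = k}"
  by (auto simp: monomials_def mdeg_def)

lemma exponents_mdeg_2:
  assumes "mdeg u = 2"
  obtains a c where "u = Poly_Mapping.single a 1 + Poly_Mapping.single c 1"
proof -
  obtain a v where v: "u = Poly_Mapping.single a 1 + v"
    using mdeg_pos_split[of u] assms by auto
  then have "mdeg v = 1"
    using assms by simp
  then obtain c t where t: "v = Poly_Mapping.single c 1 + t"
    using mdeg_pos_split[of v] by auto
  then have "mdeg t = 0"
    using \<open>mdeg v = 1\<close> by simp
  then have "t = 0"
    using mdeg_pos_split[of t] by (auto simp: mdeg_def intro: poly_mapping_eqI)
  then show thesis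
    using that t v by simp
qed

section \<open>Rings given by type classes and their ideals\<close>

lemma type_algebra_simps [simp]:
  "carrier (ring_of_type_algebra :: 'a::comm_ring_1 ring) = UNIV"
  "x \<otimes>\<^bsub>ring_of_type_algebra\<^esub> y = x * (y::'a)"
  "x \<oplus>\<^bsub>ring_of_type_algebra\<^esub> y = x + (y::'a)"
  "\<zero>\<^bsub>ring_of_type_algebra\<^esub> = (0::'a)"
  "\<one>\<^bsub>ring_of_type_algebra\<^esub> = (1::'a)"
  by (simp_all add: ring_of_type_algebra_def)

lemma type_algebra_a_minus [simp]: "\<ominus>\<^bsub>ring_of_type_algebra\<^esub> x = - (x :: 'a::comm_ring_1)"
proof -
  interpret ring "ring_of_type_algebra :: 'a ring" ..
  show ?thesis by (rule minus_equality) auto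
qed

lemma ideal_type_algebra_iff:
  "ideal J (ring_of_type_algebra :: 'a::comm_ring_1 ring) \<longleftrightarrow>
    0 \<in> J \<and> (\<forall>f\<in>J. \<forall>g\<in>J. f + g \<in> J) \<and> (\<forall>f\<in>J. \<forall>g. g * f \<in> J)"
proof
  assume "ideal J (ring_of_type_algebra :: 'a ring)"
  then interpret ideal J "ring_of_type_algebra :: 'a ring" .
  show "0 \<in> J \<and> (\<forall>f\<in>J. \<forall>g\<in>J. f + g \<in> J) \<and> (\<forall>f\<in>J. \<forall>g. g * f \<in> J)"
  proof (intro conjI ballI allI)
    show "0 \<in> J" using additive_subgroup.zero_closed[OF is_additive_subgroup] by simp
    show "f + g \<in> J" if "f \<in> J" "g \<in> J" for f g using additive_subgroup.a_closed[OF is_additive_subgroup that] by simp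
    show "g * f \<in> J" if "f \<in> J" for f g using I_l_closed[OF that, of g] by simp
  qed
next
  interpret R: ring "ring_of_type_algebra :: 'a ring" ..
  assume J: "0 \<in> J \<and> (\<forall>f\<in>J. \<forall>g\<in>J. f + g \<in> J) \<and> (\<forall>f\<in>J. \<forall>g. g * f \<in> J)"
  have neg: "- f \<in> J" if "f \<in> J" for f
    using J that by (metis mult_minus1)
  show "ideal J (ring_of_type_algebra :: 'a ring)"
  proof (rule idealI)
    show "subgroup J (add_monoid (ring_of_type_algebra :: 'a ring))"
      by (rule R.add.subgroupI) (use J neg in \<open>auto simp flip: a_inv_def\<close>)
  qed (use J in \<open>auto simp: mult.commute intro: R.ring_axioms\<close>)
qed

lemma push_exponents_Idl_binomials:
  fixes B :: "('x, 'k::field) mpoly set"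
  assumes B: "\<And>b. b \<in> B \<Longrightarrow> \<exists>u v. b = Poly_Mapping.single u 1 - Poly_Mapping.single v 1 \<and> (\<forall>t. h (t + u) = h (t + v))"
    and f: "f \<in> Idl\<^bsub>poly_ring\<^esub> B"
  shows "push_exponents h f = 0"
proof -
  interpret R: ring "poly_ring :: ('x, 'k) mpoly ring" ..
  \<comment> \<open>The kernel of a merely linear map need not be an ideal. \<open>J\<close> is the
    largest ideal inside the kernel, so the minimality of the generated ideal applies to it.\<close>
  define J :: "('x, 'k) mpoly set" where "J = {f. \<forall>g. push_exponents h (g * f) = 0}"
  have "ideal J poly_ring"
    by (auto simp: ideal_type_algebra_iff J_def distrib_left push_exponents_add simp flip: mult.assoc)
  moreover have "B \<subseteq> J"
  proof
    fix b
    assume "b \<in> B"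
    then show "b \<in> J"
      using B[of b] push_exponents_mult_binomial[of h] by (auto simp: J_def)
  qed
  ultimately have "f \<in> J"
    using R.genideal_minimal[of J B] f by blast
  then have "push_exponents h (1 * f) = 0"
    unfolding J_def by blast
  then show ?thesis by simp
qed

section \<open>Quadratic binomials of the toric ideal\<close>

text \<open>The exponent of the variable of the vertex \<open>p\<close> in the image under
  \<open>toric_hom\<close> of the monomial with exponent \<open>u\<close>.\<close>

definition vertex_weight :: "('e::finite \<Rightarrow> 'v set) \<Rightarrow> ('e \<Rightarrow>\<^sub>0 nat) \<Rightarrow> 'v \<Rightarrow> nat" where
  "vertex_weight edge u p = (\<Sum>i\<in>UNIV. Poly_Mapping.lookup u i * of_bool (p \<in> edge i))"

lemma vertex_weight_add:
  "vertex_weight edge (u + v) p = vertex_weight edge u p + vertex_weight edge v p"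
  by (simp add: vertex_weight_def lookup_add distrib_right sum.distrib)

lemma vertex_weight_single: "vertex_weight edge (Poly_Mapping.single i 1) p = of_bool (p \<in> edge i)"
proof -
  have "vertex_weight edge (Poly_Mapping.single i 1) p = (\<Sum>j\<in>UNIV. if i = j then of_bool (p \<in> edge i) else 0)"
    unfolding vertex_weight_def by (rule sum.cong) (auto simp: lookup_single)
  then show ?thesis by simp
qed

lemma toric_hom_single_diff:
  fixes edge :: "'e::finite \<Rightarrow> 'v::finite set"
  assumes "u \<noteq> v"
  shows "(toric_hom edge (Poly_Mapping.single u 1 - Poly_Mapping.single v 1) :: ('v, 'k::field) mpoly) = 0 \<longleftrightarrow>
    vertex_weight edge u = vertex_weight edge v"
proof -
  \<comment> \<open>\<open>T u\<close> is the exponent vector of the image monomial. The inner sum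
    over j stands for a power, written as a repeated product so that \<open>prod_single_1\<close>
    applies at every level.\<close>
  define T where "T u = (\<Sum>i\<in>UNIV. \<Sum>j<Poly_Mapping.lookup u i. \<Sum>p\<in>edge i. Poly_Mapping.single p (1::nat))" for u :: "'e \<Rightarrow>\<^sub>0 nat"
  have lookup_T: "Poly_Mapping.lookup (T u) p = vertex_weight edge u p" for u p
  proof -
    have "(\<Sum>q\<in>edge i. Poly_Mapping.lookup (Poly_Mapping.single q (1::nat)) p) = of_bool (p \<in> edge i)" for i
    proof -
      have "(\<Sum>q\<in>edge i. Poly_Mapping.lookup (Poly_Mapping.single q (1::nat)) p) = (\<Sum>q\<in>edge i. if q = p then 1 else 0)"
        by (rule sum.cong) (auto simp: lookup_single)
      then show ?thesis by simp
    qed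
    then show ?thesis
      by (simp add: T_def vertex_weight_def lookup_sum)
  qed
  have T_eq: "T u = T v \<longleftrightarrow> vertex_weight edge u = vertex_weight edge v"
    by (metis (no_types, lifting) ext lookup_T poly_mapping_eqI)
  have monomial_image: "(\<Prod>i\<in>UNIV. (\<Prod>v\<in>edge i. Var v) ^ Poly_Mapping.lookup u i) = (Poly_Mapping.single (T u) 1 :: ('v, 'k) mpoly)" for u
  proof -
    have "x ^ n = (\<Prod>j<n. x)" for x :: "('v, 'k) mpoly" and n
      by simp
    then show ?thesis
      unfolding Var_def T_def by (simp only: prod_single_1)
  qed
  have coeffs: "Poly_Mapping.lookup (Poly_Mapping.single u 1 - Poly_Mapping.single v 1 :: ('e, 'k) mpoly) w =
    (if w = u then 1 else if w = v then -1 else 0)" for w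
    using assms by (auto simp: lookup_minus lookup_single)
  have keys: "Poly_Mapping.keys (Poly_Mapping.single u 1 - Poly_Mapping.single v 1 :: ('e, 'k) mpoly) = {u, v}"
    by (auto simp: in_keys_iff coeffs split: if_splits)
  have "toric_hom edge (Poly_Mapping.single u 1 - Poly_Mapping.single v 1 :: ('e, 'k) mpoly) =
    Poly_Mapping.single (T u) 1 - Poly_Mapping.single (T v) 1"
    unfolding toric_hom_def keys monomial_image using assms
    by (simp add: coeffs Const_mult_single single_uminus)
  moreover have "(Poly_Mapping.single (T u) 1 - Poly_Mapping.single (T v) 1 :: ('v, 'k) mpoly) = 0 \<longleftrightarrow> T u = T v"
  proof
    assume "(Poly_Mapping.single (T u) 1 - Poly_Mapping.single (T v) 1 :: ('v, 'k) mpoly) = 0"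
    then have "Poly_Mapping.keys (Poly_Mapping.single (T u) 1 :: ('v, 'k) mpoly) = Poly_Mapping.keys (Poly_Mapping.single (T v) 1 :: ('v, 'k) mpoly)"
      by simp
    then show "T u = T v" by simp
  qed simp
  ultimately show ?thesis
    by (simp add: T_eq)
qed

section \<open>Opposite edges of 4-cycles and quadratic binomials\<close>

lemma consecutive_edgesD:
  assumes "consecutive_edges edge a b c d"
  shows "edge a \<inter> edge c = {}" "edge c \<inter> edge a = {}" "edge b \<inter> edge d = {}" "edge d \<inter> edge b = {}"
    "edge a \<inter> edge b \<noteq> {}" "edge b \<inter> edge c \<noteq> {}" "edge c \<inter> edge d \<noteq> {}" "edge d \<inter> edge a \<noteq> {}"
    "edge b \<inter> edge a \<noteq> {}" "edge c \<inter> edge b \<noteq> {}" "edge d \<inter> edge c \<noteq> {}" "edge a \<inter> edge d \<noteq> {}"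
    "distinct [a, b, c, d]"
proof -
  obtain v1 v2 v3 v4 where v: "distinct [v1, v2, v3, v4]" "edge a = {v1, v2}" "edge b = {v2, v3}"
    "edge c = {v3, v4}" "edge d = {v4, v1}"
    using assms unfolding consecutive_edges_def by blast
  then show "edge a \<inter> edge c = {}" "edge c \<inter> edge a = {}" "edge b \<inter> edge d = {}" "edge d \<inter> edge b = {}"
    "edge a \<inter> edge b \<noteq> {}" "edge b \<inter> edge c \<noteq> {}" "edge c \<inter> edge d \<noteq> {}" "edge d \<inter> edge a \<noteq> {}"
    "edge b \<inter> edge a \<noteq> {}" "edge c \<inter> edge b \<noteq> {}" "edge d \<inter> edge c \<noteq> {}" "edge a \<inter> edge d \<noteq> {}"
    by auto
  have "edge a \<noteq> edge b" "edge a \<noteq> edge c" "edge a \<noteq> edge d" "edge b \<noteq> edge c" "edge b \<noteq> edge d" "edge c \<noteq> edge d"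
    using v by (auto simp: doubleton_eq_iff)
  then show "distinct [a, b, c, d]"
    by auto
qed

text \<open>Neighbouring edges of a 4-cycle meet and opposite ones are disjoint, so the edge set
  alone determines the two opposite pairs. Only their order remains free.\<close>

lemma consecutive_edges_same_cycle:
  assumes "consecutive_edges edge a b c d" "consecutive_edges edge a' b' c' d'"
    and "{a, b, c, d} = {a', b', c', d'}"
  shows "({a', c'} = {a, c} \<and> {b', d'} = {b, d}) \<or> ({a', c'} = {b, d} \<and> {b', d'} = {a, c})"
proof -
  note D = consecutive_edgesD[OF assms(1)] and D' = consecutive_edgesD[OF assms(2)]
  have mem: "a' \<in> {a, b, c, d}" "c' \<in> {a, b, c, d}"
    using assms(3) by auto
  have opp: "edge a' \<inter> edge c' = {}" "a' \<noteq> c'"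
    using D' by auto
  have "{a', c'} = {a, c} \<or> {a', c'} = {b, d}"
    using mem opp D(5-12) by auto
  moreover have "{b', d'} = {a, b, c, d} - {a', c'}"
    unfolding assms(3) using D'(13) by auto
  moreover have "{a, b, c, d} - {a, c} = {b, d}" "{a, b, c, d} - {b, d} = {a, c}"
    using D(13) by auto
  ultimately show ?thesis
    by metis
qed

lemma vertex_weight_consecutive:
  assumes "consecutive_edges edge a b c d"
  shows "vertex_weight edge (Poly_Mapping.single a 1 + Poly_Mapping.single c 1) =
    vertex_weight edge (Poly_Mapping.single b 1 + Poly_Mapping.single d 1)"
  unfolding fun_eq_iff vertex_weight_add vertex_weight_single
  using assms by (auto simp: consecutive_edges_def)

text \<open>Equal weights mean that the edges a, c have the same ends, with multiplicity, as b, d.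
  Since the two monomials differ, \<open>a\<close> shares exactly one end with \<open>b\<close> and
  the other with \<open>d\<close>. The remaining ends of \<open>b\<close> and \<open>d\<close> must
  be those of \<open>c\<close>, which closes a 4-cycle.\<close>

lemma consecutive_edges_of_vertex_weight:
  assumes simple: "simple_graph edge"
    and weight: "vertex_weight edge (Poly_Mapping.single a 1 + Poly_Mapping.single c 1) =
      vertex_weight edge (Poly_Mapping.single b 1 + Poly_Mapping.single d 1)"
    and neq: "Poly_Mapping.single a (1::nat) + Poly_Mapping.single c 1 \<noteq> Poly_Mapping.single b 1 + Poly_Mapping.single d 1"
  shows "consecutive_edges edge a b c d"
proof -
  \<comment> \<open>Two sums of two truth values agree exactly when the conjunctions and the
    disjunctions agree.\<close>
  have W: "p \<in> edge a \<and> p \<in> edge c \<longleftrightarrow> p \<in> edge b \<and> p \<in> edge d"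
    "p \<in> edge a \<or> p \<in> edge c \<longleftrightarrow> p \<in> edge b \<or> p \<in> edge d" for p
    using fun_cong[OF weight, of p] unfolding vertex_weight_add vertex_weight_single
    by (cases "p \<in> edge a"; cases "p \<in> edge b"; cases "p \<in> edge c"; cases "p \<in> edge d"; simp)+
  have edge_inj: "i = j" if "edge i = edge j" for i j
    using simple that by (auto simp: simple_graph_def inj_def)
  have ends: "card (edge i) = 2" for i
    using simple by (simp add: simple_graph_def)
  have ab: "edge a \<noteq> edge b"
  proof
    assume "edge a = edge b"
    then have "edge c = edge d" using W by blast
    with \<open>edge a = edge b\<close> show False using edge_inj[of a b] edge_inj[of c d] neq by simp
  qed
  have ad: "edge a \<noteq> edge d"
  proof
    assume "edge a = edge d"
    then have "edge c = edge b" using W by blast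
    with \<open>edge a = edge d\<close> show False using edge_inj[of a d] edge_inj[of c b] neq by (simp add: add.commute)
  qed
  obtain p' q' where pq': "edge a = {p', q'}" "p' \<noteq> q'"
    using ends[of a] by (auto simp: card_2_iff)
  have not_sub: "\<not> {p', q'} \<subseteq> edge b" "\<not> {p', q'} \<subseteq> edge d"
    using ends pq' ab ad card_subset_eq[of "edge b" "{p', q'}"] card_subset_eq[of "edge d" "{p', q'}"]
    by (auto simp: card_ge_0_finite)
  have "p' \<in> edge b \<or> p' \<in> edge d" "q' \<in> edge b \<or> q' \<in> edge d"
    using W[of p'] W[of q'] pq' by auto
  \<comment> \<open>The ends of \<open>a\<close> are renamed, swapped if necessary, so that q lies
    on \<open>b\<close> and p on \<open>d\<close>.\<close>
  then obtain p q where pq: "edge a = {p, q}" "p \<noteq> q" "q \<in> edge b" "p \<in> edge d" "p \<notin> edge b" "q \<notin> edge d"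
    using not_sub pq' by (metis empty_subsetI insert_commute insert_subset)
  have notin_c: "p \<notin> edge c" "q \<notin> edge c"
    using W[of p] W[of q] pq by auto
  have other_end: "\<exists>y. edge i = {x, y} \<and> y \<noteq> x" if x: "x \<in> edge i" for i x
  proof -
    obtain y1 y2 where y: "edge i = {y1, y2}" "y1 \<noteq> y2"
      using ends[of i] by (auto simp: card_2_iff)
    with x consider "x = y1" | "x = y2" by auto
    then show ?thesis
      using y insert_commute[of y1 y2 "{}"] by cases blast+
  qed
  obtain r where r: "edge b = {q, r}" "r \<noteq> q"
    using other_end pq(3) by blast
  obtain s where s: "edge d = {s, p}" "s \<noteq> p"
    using other_end[OF pq(4)] by (auto simp: insert_commute)
  have "r \<noteq> p" "s \<noteq> q"
    using r s pq by auto
  then have rs: "r \<in> edge c" "s \<in> edge c" "r \<noteq> s"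
    using W[of r] W[of s] r s pq by auto
  obtain y where "edge c = {r, y}"
    using other_end[OF rs(1)] by blast
  then have "edge c = {r, s}"
    using rs by auto
  moreover have "distinct [p, q, r, s]"
    using pq(2) r(2) s(2) rs(3) \<open>r \<noteq> p\<close> \<open>s \<noteq> q\<close> by (simp add: eq_commute)
  ultimately show ?thesis
    unfolding consecutive_edges_def using pq(1) r(1) s(1) by blast
qed

section \<open>Quotients of ideals as vector spaces\<close>

text \<open>The image of \<open>M\<close> is an ideal of R/N, and scalars act through the composite
  ring homomorphism from K to R/N. The module laws are therefore instances of ring laws of
  R/N.\<close>

lemma vectorspace_quotient_space:
  assumes K: "field K" and R: "cring R" and \<iota>: "\<iota> \<in> ring_hom K R"
    and M: "ideal M R" and N: "ideal N R"
  shows "vectorspace K (quotient_space R \<iota> M N)"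
proof -
  let ?V = "quotient_space R \<iota> M N"
  interpret K: field K by (rule K)
  interpret R: cring R by (rule R)
  interpret N: ideal N R by (rule N)
  interpret Q: cring "R Quot N" by (rule N.quotient_is_cring[OF R])
  interpret MN: ideal "(+>\<^bsub>R\<^esub>) N ` M" "R Quot N"
    by (rule R.ring_ideal_imp_quot_ideal[OF N M])
  define \<kappa> where "\<kappa> = (\<lambda>a. N +>\<^bsub>R\<^esub> \<iota> a)"
  have "(+>\<^bsub>R\<^esub>) N \<circ> \<iota> \<in> ring_hom K (R Quot N)"
    by (rule ring_hom_trans[OF \<iota> N.rcos_ring_hom])
  then have \<kappa>: "\<kappa> \<in> ring_hom K (R Quot N)"
    by (simp add: \<kappa>_def comp_def)
  have V: "carrier ?V = (+>\<^bsub>R\<^esub>) N ` M" "\<zero>\<^bsub>?V\<^esub> = \<zero>\<^bsub>R Quot N\<^esub>" "x \<oplus>\<^bsub>?V\<^esub> y = x \<oplus>\<^bsub>R Quot N\<^esub> y"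
    "a \<odot>\<^bsub>?V\<^esub> x = \<kappa> a \<otimes>\<^bsub>R Quot N\<^esub> x" for a x y
    by (simp_all add: quotient_space_def \<kappa>_def)
  note sub = MN.Icarr and closed = additive_subgroup.a_closed[OF MN.is_additive_subgroup]
    additive_subgroup.zero_closed[OF MN.is_additive_subgroup]
    additive_subgroup.a_inv_closed[OF MN.is_additive_subgroup]
  have "abelian_group ?V"
  proof (rule abelian_groupI)
    fix x
    assume "x \<in> carrier ?V"
    then show "\<exists>y\<in>carrier ?V. y \<oplus>\<^bsub>?V\<^esub> x = \<zero>\<^bsub>?V\<^esub>"
      unfolding V using closed(3) sub Q.l_neg by blast
  qed (simp_all only: V closed sub Q.a_assoc Q.l_zero, simp add: sub Q.a_comm)
  then have "module K ?V"
    by (intro moduleI K.cring_axioms)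
      (simp_all add: V MN.I_l_closed sub ring_hom_closed[OF \<kappa>] ring_hom_add[OF \<kappa>] ring_hom_mult[OF \<kappa>]
        ring_hom_one[OF \<kappa>] Q.l_distr Q.r_distr Q.m_assoc)
  then show ?thesis
    using K by (simp add: vectorspace_def)
qed

lemma (in ideal) rcos_eq_zero_iff: "x \<in> carrier R \<Longrightarrow> I +> x = \<zero>\<^bsub>R Quot I\<^esub> \<longleftrightarrow> x \<in> I"
  using rcos_const_imp_mem[of x] a_rcos_zero[OF is_ideal, of x] by (auto simp: FactRing_def)

section \<open>Powers of the maximal ideal and their quotients\<close>

lemma ideal_terms_ge: "ideal (terms_ge k) (poly_ring :: ('x::finite, 'k::field) mpoly ring)"
  unfolding ideal_type_algebra_iff
proof (intro conjI ballI allI)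
  show "g * f \<in> terms_ge k" if "f \<in> terms_ge k" for f g :: "('x, 'k) mpoly"
    using terms_ge_mult[of g 0 f k] that by (simp add: terms_ge_0)
qed (simp_all add: zero_in_terms_ge terms_ge_add)

text \<open>
  That the toric ideal is an ideal is assumed here: in the theorem it is a generated ideal by
  hypothesis, so the multiplicativity of \<open>toric_hom\<close> is not needed.
\<close>

locale toric_ideal_is_ideal =
  fixes edge :: "'e::finite \<Rightarrow> 'v::finite set" and I :: "('e, 'k::field) mpoly set"
  assumes I_eq: "I = toric_ideal edge"
    and ideal_I: "ideal I poly_ring"
begin

abbreviation cls :: "('e, 'k) mpoly \<Rightarrow> ('e, 'k) mpoly set" where
  "cls \<equiv> toric_class edge"

abbreviation RR :: "('e, 'k) mpoly set ring" where
  "RR \<equiv> toric_ring edge"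

lemma cls_eq: "cls = (+>\<^bsub>poly_ring\<^esub>) I"
  by (rule ext) (simp add: toric_class_def I_eq)

lemma RR_eq: "RR = poly_ring Quot I"
  by (simp add: toric_ring_def I_eq)

lemma cring_RR: "cring RR"
  unfolding RR_eq by (rule ideal.quotient_is_cring[OF ideal_I]) (rule cring_from_type_algebra)

sublocale RR: cring RR
  by (rule cring_RR)

lemma cls_hom: "cls \<in> ring_hom poly_ring RR"
  unfolding cls_eq RR_eq by (rule ideal.rcos_ring_hom[OF ideal_I])

lemma cls_simps:
  "cls f \<in> carrier RR" "cls (f + g) = cls f \<oplus>\<^bsub>RR\<^esub> cls g" "cls (f * g) = cls f \<otimes>\<^bsub>RR\<^esub> cls g"
  using ring_hom_closed[OF cls_hom, of f] ring_hom_add[OF cls_hom, of f g] ring_hom_mult[OF cls_hom, of f g]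
  by simp_all

lemma carrier_RR: "carrier RR = range cls"
  unfolding RR_eq cls_eq FactRing_def A_RCOSETS_def' by auto

lemma cls_eq_zero_iff: "cls f = \<zero>\<^bsub>RR\<^esub> \<longleftrightarrow> f \<in> I"
  unfolding cls_eq RR_eq by (rule ideal.rcos_eq_zero_iff[OF ideal_I]) simp

lemma cls_zero: "cls 0 = \<zero>\<^bsub>RR\<^esub>"
  using ideal_I by (simp add: cls_eq_zero_iff ideal_type_algebra_iff)

lemma cls_eq_iff: "cls f = cls g \<longleftrightarrow> f - g \<in> I"
proof -
  have "cls f = cls (f - g) \<oplus>\<^bsub>RR\<^esub> cls g"
    using cls_simps(2)[of "f - g" g] by simp
  moreover have "cls (f - g) \<oplus>\<^bsub>RR\<^esub> cls g = cls g \<longleftrightarrow> cls (f - g) = \<zero>\<^bsub>RR\<^esub>"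
    using RR.add.r_cancel_one[of "cls g" "cls (f - g)"] by (simp add: cls_simps)
  ultimately show ?thesis
    by (simp add: cls_eq_zero_iff)
qed

lemma ideal_cls_image:
  assumes "ideal J poly_ring"
  shows "ideal (cls ` J) RR"
proof -
  interpret P: ring "poly_ring :: ('e, 'k) mpoly ring" ..
  show ?thesis
    unfolding cls_eq RR_eq by (rule P.ring_ideal_imp_quot_ideal[OF ideal_I assms])
qed

lemma Var_mult_single_cls:
  "cls (Poly_Mapping.single (Poly_Mapping.single i 1 + v) c) = cls (Var i) \<otimes>\<^bsub>RR\<^esub> cls (Poly_Mapping.single v c)"
  by (simp add: Var_def mult_single flip: cls_simps(3))

text \<open>The image of \<open>terms_ge 1\<close> is an ideal containing the generators. Conversely
  a term of positive degree has a variable as a factor, so its class lies in the generated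
  ideal.\<close>

lemma toric_max_eq: "toric_max edge = cls ` terms_ge 1"
proof
  have "cls (Var i) \<in> cls ` terms_ge 1" for i
    by (intro imageI) (simp add: Var_def terms_ge_def)
  then show "toric_max edge \<subseteq> cls ` terms_ge 1"
    unfolding toric_max_def by (intro RR.genideal_minimal ideal_cls_image ideal_terms_ge) auto
next
  have range_carr: "range (\<lambda>i. cls (Var i)) \<subseteq> carrier RR"
    by (auto simp: cls_simps)
  interpret max: ideal "toric_max edge" RR
    unfolding toric_max_def by (rule RR.genideal_ideal[OF range_carr])
  have Var: "cls (Var i) \<in> toric_max edge" for i
    using RR.genideal_self[OF range_carr] unfolding toric_max_def by auto
  have "f \<in> {f. cls f \<in> toric_max edge}" if f: "f \<in> terms_ge 1" for f
  proof (rule mem_closed_under_terms)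
    fix u
    assume "u \<in> Poly_Mapping.keys f"
    then have "0 < mdeg u"
      using f by (auto simp: terms_ge_def)
    then obtain i v where "u = Poly_Mapping.single i 1 + v"
      by (rule mdeg_pos_split)
    then show "Poly_Mapping.single u (Poly_Mapping.lookup f u) \<in> {f. cls f \<in> toric_max edge}"
      using max.I_r_closed[OF Var, of "cls (Poly_Mapping.single v (Poly_Mapping.lookup f u))" i]
      by (simp only: mem_Collect_eq Var_mult_single_cls cls_simps)
  qed (simp_all add: cls_zero cls_simps additive_subgroup.zero_closed[OF max.is_additive_subgroup]
      additive_subgroup.a_closed[OF max.is_additive_subgroup])
  then show "cls ` terms_ge 1 \<subseteq> toric_max edge"
    by auto
qed

text \<open>By induction: degrees add under products, and a term of degree at least k + 1 is a
  variable times a term of degree at least k that keeps the coefficient.\<close>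

lemma toric_max_pow_eq: "toric_max_pow edge k = cls ` terms_ge k"
proof (induction k)
  case 0
  then show ?case
    by (simp add: toric_max_pow_def nat_pow_def ideals_set_def terms_ge_0 carrier_RR)
next
  case (Suc k)
  have "toric_max_pow edge (Suc k) = ideal_prod RR (cls ` terms_ge k) (cls ` terms_ge 1)"
    using Suc by (simp add: toric_max_pow_def nat_pow_def ideals_set_def toric_max_eq)
  also have "\<dots> = cls ` terms_ge (Suc k)"
  proof
    show "ideal_prod RR (cls ` terms_ge k) (cls ` terms_ge 1) \<subseteq> cls ` terms_ge (Suc k)"
    proof
      fix x
      assume "x \<in> ideal_prod RR (cls ` terms_ge k) (cls ` terms_ge 1)"
      then show "x \<in> cls ` terms_ge (Suc k)"
      proof (induction rule: ideal_prod.induct)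
        case (prod i j)
        then obtain f g where "i = cls f" "j = cls g" "f \<in> terms_ge k" "g \<in> terms_ge 1"
          by blast
        then show ?case
          using terms_ge_mult[of f k g 1] by (simp flip: cls_simps(3))
      next
        case (sum s1 s2)
        then obtain f g where "s1 = cls f" "s2 = cls g" "f \<in> terms_ge (Suc k)" "g \<in> terms_ge (Suc k)"
          by blast
        then show ?case
          using terms_ge_add[of f "Suc k" g] by (simp flip: cls_simps(2))
      qed
    qed
  next
    let ?J = "{f. cls f \<in> ideal_prod RR (cls ` terms_ge k) (cls ` terms_ge 1)}"
    have prod: "cls f \<otimes>\<^bsub>RR\<^esub> cls g \<in> ideal_prod RR (cls ` terms_ge k) (cls ` terms_ge 1)"
      if "f \<in> terms_ge k" "g \<in> terms_ge 1" for f g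
      using that by (intro ideal_prod.prod imageI)
    have "f \<in> ?J" if f: "f \<in> terms_ge (Suc k)" for f
    proof (rule mem_closed_under_terms)
      fix u
      assume u: "u \<in> Poly_Mapping.keys f"
      then have "0 < mdeg u"
        using f by (auto simp: terms_ge_def)
      then obtain i v where v: "u = Poly_Mapping.single i 1 + v"
        by (rule mdeg_pos_split)
      then have "k \<le> mdeg v"
        using f u by (auto simp: terms_ge_def)
      then have "cls (Poly_Mapping.single v (Poly_Mapping.lookup f u)) \<otimes>\<^bsub>RR\<^esub> cls (Var i) \<in> ideal_prod RR (cls ` terms_ge k) (cls ` terms_ge 1)"
        by (intro prod) (simp_all add: terms_ge_def Var_def)
      then have "cls (Poly_Mapping.single (Poly_Mapping.single i 1 + v) (Poly_Mapping.lookup f u)) \<in> ideal_prod RR (cls ` terms_ge k) (cls ` terms_ge 1)"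
        unfolding Var_mult_single_cls by (subst RR.m_comm) (simp_all only: cls_simps)
      then show "Poly_Mapping.single u (Poly_Mapping.lookup f u) \<in> ?J"
        using v by simp
    next
      \<comment> \<open>\<open>ideal_prod\<close> is generated by products and sums only, so zero is
        obtained as a product of zeros.\<close>
      show "0 \<in> ?J"
        using prod[of 0 0] by (simp add: zero_in_terms_ge flip: cls_simps(3))
      show "f + g \<in> ?J" if "f \<in> ?J" "g \<in> ?J" for f g
        using that by (simp add: cls_simps ideal_prod.sum)
    qed
    then show "cls ` terms_ge (Suc k) \<subseteq> ideal_prod RR (cls ` terms_ge k) (cls ` terms_ge 1)"
      by auto
  qed
  finally show ?case .
qed

lemma ideal_toric_max_pow: "ideal (toric_max_pow edge k) RR"
  unfolding toric_max_pow_eq by (intro ideal_cls_image ideal_terms_ge)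

section \<open>Residues of polynomials in the graded pieces\<close>

lemma toric_residue_hom:
  "toric_residue edge k \<in> ring_hom poly_ring (RR Quot toric_max_pow edge (k + 1))"
proof -
  have "toric_residue edge k = (+>\<^bsub>RR\<^esub>) (toric_max_pow edge (k + 1)) \<circ> cls"
    by (rule ext) (simp add: toric_residue_def)
  then show ?thesis
    using ring_hom_trans[OF cls_hom ideal.rcos_ring_hom[OF ideal_toric_max_pow]] by simp
qed

text \<open>By \<open>toric_max_pow_eq\<close>, vanishing in the iterated quotient becomes a
  congruence between polynomials modulo \<open>I\<close>.\<close>

lemma toric_residue_eq_zero_iff:
  "toric_residue edge k f = \<zero>\<^bsub>RR Quot toric_max_pow edge (k + 1)\<^esub> \<longleftrightarrow> (\<exists>g\<in>terms_ge (k + 1). f - g \<in> I)"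
  unfolding toric_residue_def
  by (subst ideal.rcos_eq_zero_iff[OF ideal_toric_max_pow])
    (auto simp: cls_simps toric_max_pow_eq cls_eq_iff)

lemma vectorspace_toric_graded_piece:
  "vectorspace (ring_of_type_algebra :: 'k ring) (toric_graded_piece edge k)"
proof -
  have "Const \<in> ring_hom (ring_of_type_algebra :: 'k ring) poly_ring"
    by (rule ring_hom_memI) (simp_all add: Const_def mult_single single_add)
  then have "cls \<circ> Const \<in> ring_hom ring_of_type_algebra RR"
    by (rule ring_hom_trans[OF _ cls_hom])
  then show ?thesis
    unfolding toric_graded_piece_def
    by (intro vectorspace_quotient_space field_from_type_algebra cring_RR ideal_toric_max_pow)
      (simp add: comp_def)
qed

lemma toric_graded_piece_simps:
  fixes f g :: "('e, 'k) mpoly"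
  shows "carrier (toric_graded_piece edge k) = toric_residue edge k ` (terms_ge k :: ('e, 'k) mpoly set)"
  "\<zero>\<^bsub>toric_graded_piece edge k\<^esub> = \<zero>\<^bsub>RR Quot toric_max_pow edge (k + 1)\<^esub>"
  "toric_residue edge k f \<oplus>\<^bsub>toric_graded_piece edge k\<^esub> toric_residue edge k g = toric_residue edge k (f + g)"
  "a \<odot>\<^bsub>toric_graded_piece edge k\<^esub> toric_residue edge k f = toric_residue edge k (Const a * f)"
  using ring_hom_add[OF toric_residue_hom, of f g k] ring_hom_mult[OF toric_residue_hom, of "Const a" f k]
  by (simp_all add: toric_graded_piece_def quotient_space_def toric_max_pow_eq image_image toric_residue_def)

text \<open>Translates the basis property into statements on polynomials: those supported on
  \<open>U\<close> are the linear combinations of the candidate monomials. Since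
  \<open>basis\<close> speaks of a set of vectors, injectivity is recorded separately to obtain an
  indexed basis.\<close>

lemma toric_graded_piece_basis:
  fixes U :: "('e \<Rightarrow>\<^sub>0 nat) set"
  assumes mdeg_U: "\<And>u. u \<in> U \<Longrightarrow> mdeg u = k"
    and indep: "\<And>F g. Poly_Mapping.keys F \<subseteq> U \<Longrightarrow> g \<in> terms_ge (k + 1) \<Longrightarrow> F - g \<in> I \<Longrightarrow> F = 0"
    and gen: "\<And>f. f \<in> terms_ge k \<Longrightarrow>
      \<exists>F g. Poly_Mapping.keys F \<subseteq> U \<and> g \<in> terms_ge (k + 1) \<and> f - F - g \<in> I"
  shows "inj_on (toric_residue edge k) ((\<lambda>u. Poly_Mapping.single u (1::'k)) ` U)"
    and "vectorspace.basis (ring_of_type_algebra :: 'k ring) (toric_graded_piece edge k)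
      (toric_residue edge k ` (\<lambda>u. Poly_Mapping.single u (1::'k)) ` U)"
proof -
  let ?V = "toric_graded_piece edge k :: ('k, ('e, 'k) mpoly set set) module"
  define res :: "('e, 'k) mpoly \<Rightarrow> ('e, 'k) mpoly set set" where "res = toric_residue edge k"
  define e where "e u = res (Poly_Mapping.single u 1)" for u
  note V_simps = toric_graded_piece_simps[of k, folded res_def]
  interpret V: vectorspace "ring_of_type_algebra :: 'k ring" ?V
    by (rule vectorspace_toric_graded_piece)
  have finite_U: "finite U"
    by (rule finite_subset[OF _ finite_mdeg[of k]]) (auto simp: mdeg_U)
  have res_eq_zero_iff: "res F = \<zero>\<^bsub>?V\<^esub> \<longleftrightarrow> (\<exists>g\<in>terms_ge (k + 1). F - g \<in> I)" for F
    unfolding res_def V_simps by (rule toric_residue_eq_zero_iff)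
  have res_zero: "res 0 = \<zero>\<^bsub>?V\<^esub>"
    unfolding res_eq_zero_iff using ideal_I
    by (intro bexI[of _ 0]) (simp_all add: zero_in_terms_ge ideal_type_algebra_iff)
  have in_carrier: "res F \<in> carrier ?V" if "F \<in> terms_ge k" for F
    using that unfolding V_simps by blast
  have single_in: "Poly_Mapping.single u c \<in> terms_ge k" if "u \<in> U" for u and c :: 'k
    using mdeg_U that by (simp add: terms_ge_def)
  have e_in: "e u \<in> carrier ?V" if "u \<in> U" for u
    unfolding e_def by (intro in_carrier single_in that)
  have res_diff: "res F = res G \<longleftrightarrow> res (F - G) = \<zero>\<^bsub>?V\<^esub>" if "F \<in> terms_ge k" "G \<in> terms_ge k" for F G
  proof -
    have "F - G \<in> terms_ge k"
      using that keys_diff[of F G] by (auto simp: terms_ge_def)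
    moreover have "res F = res (F - G) \<oplus>\<^bsub>?V\<^esub> res G"
      by (simp add: V_simps)
    ultimately show ?thesis
      using V.add.r_cancel_one[of "res G" "res (F - G)"] in_carrier that by auto
  qed
  have inj_e: "inj_on e U"
  proof (rule inj_onI)
    fix u v
    assume uv: "u \<in> U" "v \<in> U" "e u = e v"
    define F :: "('e, 'k) mpoly" where "F = Poly_Mapping.single u 1 - Poly_Mapping.single v 1"
    have "res F = \<zero>\<^bsub>?V\<^esub>"
      unfolding F_def using uv res_diff[OF single_in single_in] by (simp add: e_def)
    moreover have "Poly_Mapping.keys F \<subseteq> U"
      using uv keys_diff[of "Poly_Mapping.single u (1::'k)" "Poly_Mapping.single v 1"] by (auto simp: F_def)
    ultimately have "F = 0"
      using indep[of F] by (auto simp: res_eq_zero_iff)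
    then have "Poly_Mapping.keys (Poly_Mapping.single u (1::'k)) = Poly_Mapping.keys (Poly_Mapping.single v (1::'k))"
      by (simp add: F_def)
    then show "u = v"
      by simp
  qed
  \<comment> \<open>Coefficients in \<open>lincomb\<close> are attached to vectors. As
    \<open>e\<close> is injective on \<open>U\<close>, no two exponents share a vector, and the
    combination is the residue of a single polynomial.\<close>
  have lincomb: "V.lincomb c (e ` A) = res (\<Sum>u\<in>A. Poly_Mapping.single u (c (e u)))" if "A \<subseteq> U" for c A
  proof -
    have "finite A"
      using that finite_U by (rule finite_subset)
    then show ?thesis
      using that
    proof (induction A rule: finite_induct)
      case empty
      then show ?case by (simp add: V.lincomb_def res_zero)
    next
      case (insert u A)
      have smult: "c x \<odot>\<^bsub>?V\<^esub> x \<in> carrier ?V" if "x \<in> e ` insert u A" for x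
        using that insert.prems e_in by (intro V.smult_closed) auto
      have "e u \<notin> e ` A"
        using insert inj_e by (auto simp: inj_on_def)
      then have "V.lincomb c (e ` insert u A) = c (e u) \<odot>\<^bsub>?V\<^esub> e u \<oplus>\<^bsub>?V\<^esub> V.lincomb c (e ` A)"
        unfolding V.lincomb_def image_insert using insert.hyps smult by (intro V.finsum_insert) auto
      also have "c (e u) \<odot>\<^bsub>?V\<^esub> e u = res (Poly_Mapping.single u (c (e u)))"
        unfolding e_def V_simps by (simp add: Const_mult_single)
      finally show ?case
        using insert by (simp add: V_simps)
    qed
  qed
  have lookup_sum_singles: "Poly_Mapping.lookup (\<Sum>u\<in>A. Poly_Mapping.single u (c u)) v = (if v \<in> A then c v else 0)"
    if "A \<subseteq> U" for c :: "('e \<Rightarrow>\<^sub>0 nat) \<Rightarrow> 'k" and v A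
  proof -
    have "Poly_Mapping.lookup (\<Sum>u\<in>A. Poly_Mapping.single u (c u)) v = (\<Sum>u\<in>A. if u = v then c u else 0)"
      unfolding lookup_sum by (rule sum.cong) (auto simp: lookup_single)
    then show ?thesis
      using finite_subset[OF that finite_U] by simp
  qed
  have "V.lin_indpt (e ` U)"
  proof
    assume "V.lin_dep (e ` U)"
    then obtain A' a v where A': "A' \<subseteq> e ` U" "V.lincomb a A' = \<zero>\<^bsub>?V\<^esub>" "v \<in> A'" "a v \<noteq> 0"
      unfolding V.lin_dep_def by auto
    then obtain A where A: "A \<subseteq> U" "A' = e ` A"
      by (auto simp: subset_image_iff)
    then obtain u where u: "u \<in> A" "v = e u"
      using A' by blast
    define F where "F = (\<Sum>u\<in>A. Poly_Mapping.single u (a (e u)))"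
    have "res F = \<zero>\<^bsub>?V\<^esub>"
      using A' A lincomb by (simp add: F_def)
    moreover have "Poly_Mapping.keys F \<subseteq> U"
      using A(1) lookup_sum_singles[OF A(1)] by (auto simp: in_keys_iff F_def split: if_splits)
    ultimately have "F = 0"
      using indep[of F] by (auto simp: res_eq_zero_iff)
    then show False
      using lookup_sum_singles[OF A(1), of "\<lambda>u. a (e u)" u] u A' by (simp add: F_def)
  qed
  moreover have "V.span (e ` U) = carrier ?V"
  proof
    show "V.span (e ` U) \<subseteq> carrier ?V"
      by (rule V.span_is_subset2) (auto simp: e_in)
    show "carrier ?V \<subseteq> V.span (e ` U)"
    proof
      fix x
      assume "x \<in> carrier ?V"
      then obtain f where f: "x = res f" "f \<in> terms_ge k"
        unfolding V_simps by blast
      then obtain F g where F: "Poly_Mapping.keys F \<subseteq> U" "g \<in> terms_ge (k + 1)" "f - F - g \<in> I"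
        using gen by blast
      have F_in: "F \<in> terms_ge k"
        using F(1) mdeg_U by (auto simp: terms_ge_def)
      have "res (f - F) = \<zero>\<^bsub>?V\<^esub>"
        unfolding res_eq_zero_iff using F by blast
      then have "x = res F"
        using f F_in res_diff by simp
      also have "F = (\<Sum>u\<in>U. Poly_Mapping.single u (Poly_Mapping.lookup F u))"
        using F(1) by (intro poly_mapping_eqI) (auto simp: lookup_sum_singles in_keys_iff)
      \<comment> \<open>The inverse of \<open>e\<close> on \<open>U\<close> moves the coefficients
        of \<open>F\<close> from exponents to vectors.\<close>
      also have "res \<dots> = V.lincomb (\<lambda>x. Poly_Mapping.lookup F (inv_into U e x)) (e ` U)"
        unfolding lincomb[OF order_refl] using inj_e
        by (intro arg_cong[of _ _ res] sum.cong) simp_all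
      finally show "x \<in> V.span (e ` U)"
        unfolding V.span_def using finite_U by auto
    qed
  qed
  ultimately have "V.basis (e ` U)"
    unfolding V.basis_def using e_in by auto
  then show "V.basis (toric_residue edge k ` (\<lambda>u. Poly_Mapping.single u (1::'k)) ` U)"
    by (simp add: e_def res_def image_image)
  show "inj_on (toric_residue edge k) ((\<lambda>u. Poly_Mapping.single u (1::'k)) ` U)"
    using inj_e by (auto simp: inj_on_def e_def res_def)
qed

end

section \<open>Good choices and normal forms\<close>

lemma good_choice_exponents:
  fixes edge :: "'e::finite \<Rightarrow> 'v set" and z w :: "'e set \<Rightarrow> ('e, 'k::field) mpoly"
  assumes "good_choice edge z w"
  obtains Z W :: "'e set \<Rightarrow> ('e \<Rightarrow>\<^sub>0 nat)" where
    "\<And>C. C \<in> four_cycles edge \<Longrightarrow> z C = Poly_Mapping.single (Z C) 1"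
    "\<And>C. C \<in> four_cycles edge \<Longrightarrow> \<exists>a b c d. consecutive_edges edge a b c d \<and> C = {a, b, c, d} \<and>
      Z C = Poly_Mapping.single a 1 + Poly_Mapping.single c 1 \<and>
      W C = Poly_Mapping.single b 1 + Poly_Mapping.single d 1"
    "coprime_rewriting (four_cycles edge) Z W"
proof -
  note good = assms[unfolded good_choice_def nonstandard_choice_def]
  note choice = good[THEN conjunct1, rule_format]
    and coprime = good[THEN conjunct2, THEN conjunct1, rule_format]
    and no_relation = good[THEN conjunct2, THEN conjunct2, rule_format]
  \<comment> \<open>One cyclic ordering is fixed for each 4-cycle, so that \<open>Z\<close> and
    \<open>W\<close> become functions of the cycle.\<close>
  obtain \<alpha> \<beta> \<gamma> \<delta> where opposite: "\<And>C. C \<in> four_cycles edge \<Longrightarrow>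
      consecutive_edges edge (\<alpha> C) (\<beta> C) (\<gamma> C) (\<delta> C) \<and> C = {\<alpha> C, \<beta> C, \<gamma> C, \<delta> C} \<and>
      z C = Var (\<alpha> C) * Var (\<gamma> C) \<and> w C = Var (\<beta> C) * Var (\<delta> C)"
    using choice by metis
  define Z where "Z C = Poly_Mapping.single (\<alpha> C) (1::nat) + Poly_Mapping.single (\<gamma> C) 1" for C
  define W where "W C = Poly_Mapping.single (\<beta> C) (1::nat) + Poly_Mapping.single (\<delta> C) 1" for C
  have z: "z C = Poly_Mapping.single (Z C) 1" and w: "w C = Poly_Mapping.single (W C) 1"
    and cycle: "\<exists>a b c d. consecutive_edges edge a b c d \<and> C = {a, b, c, d} \<and>
      Z C = Poly_Mapping.single a 1 + Poly_Mapping.single c 1 \<and>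
      W C = Poly_Mapping.single b 1 + Poly_Mapping.single d 1" if "C \<in> four_cycles edge" for C
    using opposite[OF that] unfolding Z_def W_def Var_mult_Var by blast+
  have "coprime_rewriting (four_cycles edge) Z W"
  proof
    fix C
    assume "C \<in> four_cycles edge"
    then show "mdeg (W C) = mdeg (Z C)"
      using cycle by fastforce
  next
    fix C D
    assume CD: "C \<in> four_cycles edge" "D \<in> four_cycles edge" "C \<noteq> D"
    show "Poly_Mapping.keys (Z C) \<inter> Poly_Mapping.keys (Z D) = {}"
    \<comment> \<open>A common index i would make \<open>Var i\<close> a common divisor, hence a
      divisor of 1, which is impossible by degree.\<close>
    proof (rule ccontr)
      assume "Poly_Mapping.keys (Z C) \<inter> Poly_Mapping.keys (Z D) \<noteq> {}"
      then obtain i where i: "Poly_Mapping.lookup (Z C) i \<noteq> 0" "Poly_Mapping.lookup (Z D) i \<noteq> 0"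
        by (auto simp: in_keys_iff)
      have "(Var i :: ('e, 'k) mpoly) dvd Poly_Mapping.single u 1" if "Poly_Mapping.lookup u i \<noteq> 0" for u
        unfolding Var_def single_1_dvd_single_1 using exponent_split[OF that] by metis
      then have "(Var i :: ('e, 'k) mpoly) dvd 1"
        using coprime[of C D "Var i"] i CD z by simp
      then have "(Var i :: ('e, 'k) mpoly) dvd Poly_Mapping.single 0 1"
        by simp
      then obtain t :: "'e \<Rightarrow>\<^sub>0 nat" where "0 = Poly_Mapping.single i 1 + t"
        unfolding Var_def single_1_dvd_single_1 by blast
      then have "mdeg (0 :: 'e \<Rightarrow>\<^sub>0 nat) = 1 + mdeg t"
        by (metis mdeg_add mdeg_single)
      then show False by simp
    qed
  next
    fix cs
    assume cs: "set cs \<subseteq> four_cycles edge" "cs \<noteq> []"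
    \<comment> \<open>Condition (b) counts its factors from 1, lists count from 0.\<close>
    define i where "i s = cs ! (s - 1)" for s
    have i: "i s \<in> four_cycles edge" if "s \<in> {1..length cs}" for s
    proof -
      have "s - 1 < length cs" using that by auto
      then show ?thesis using cs(1) nth_mem unfolding i_def by blast
    qed
    have sum_i: "(\<Sum>s=1..length cs. f (i s)) = (\<Sum>c\<leftarrow>cs. f c)" for f :: "'e set \<Rightarrow> ('e \<Rightarrow>\<^sub>0 nat)"
      by (simp add: i_def sum_list_sum_nth sum.atLeast1_atMost_eq atLeast0LessThan)
    have "(\<Prod>s=1..length cs. w (i s)) \<noteq> (\<Prod>s=1..length cs. z (i s))"
      using cs(2) i by (intro no_relation) (auto simp: Suc_le_eq)
    moreover have "(\<Prod>s=1..length cs. w (i s)) = Poly_Mapping.single (\<Sum>c\<leftarrow>cs. W c) 1"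
      "(\<Prod>s=1..length cs. z (i s)) = Poly_Mapping.single (\<Sum>c\<leftarrow>cs. Z c) 1"
      using i z w by (simp_all add: prod_single_1 flip: sum_i cong: prod.cong_simp)
    ultimately show "(\<Sum>c\<leftarrow>cs. W c) \<noteq> (\<Sum>c\<leftarrow>cs. Z c)"
      by auto
  qed
  then show thesis
    using that z cycle by blast
qed

theorem theorem3p5:
  fixes edge :: "'e::finite \<Rightarrow> 'v::finite set"
    and z w :: "'e set \<Rightarrow> ('e, 'k::field) mpoly"
    and k :: nat
  assumes "simple_graph edge" and "connected_graph edge" and "bipartite_graph edge"
    and "generated_by_quadratic_binomials (toric_ideal edge :: ('e, 'k) mpoly set)"
    and "good_choice edge z w"
  shows "vectorspace (ring_of_type_algebra :: 'k ring) (toric_graded_piece edge k) \<and>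
    inj_on (toric_residue edge k) (standard_monomials edge z k) \<and>
    vectorspace.basis (ring_of_type_algebra :: 'k ring) (toric_graded_piece edge k)
      (toric_residue edge k ` standard_monomials edge z k)"
proof -
  define I :: "('e, 'k) mpoly set" where "I = toric_ideal edge"
  obtain B where B: "B \<subseteq> quadratic_binomials" "I = Idl\<^bsub>poly_ring\<^esub> B"
    using assms(4) unfolding generated_by_quadratic_binomials_def I_def by blast
  interpret P: ring "poly_ring :: ('e, 'k) mpoly ring" ..
  have ideal_I: "ideal I poly_ring"
    unfolding B(2) by (rule P.genideal_ideal) simp
  interpret toric_ideal_is_ideal edge I
    by (rule toric_ideal_is_ideal.intro[OF I_def ideal_I])
  obtain Z W :: "'e set \<Rightarrow> ('e \<Rightarrow>\<^sub>0 nat)" where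
    z: "\<And>C. C \<in> four_cycles edge \<Longrightarrow> z C = Poly_Mapping.single (Z C) 1"
    and cycle: "\<And>C. C \<in> four_cycles edge \<Longrightarrow> \<exists>a b c d. consecutive_edges edge a b c d \<and> C = {a, b, c, d} \<and>
      Z C = Poly_Mapping.single a 1 + Poly_Mapping.single c 1 \<and>
      W C = Poly_Mapping.single b 1 + Poly_Mapping.single d 1"
    and "coprime_rewriting (four_cycles edge) Z W"
    using good_choice_exponents[OF assms(5)] by blast
  then interpret coprime_rewriting "four_cycles edge" Z W by simp

  have I_closed: "0 \<in> I" "\<And>f g. f \<in> I \<Longrightarrow> g \<in> I \<Longrightarrow> f + g \<in> I" "\<And>f g. f \<in> I \<Longrightarrow> g * f \<in> I"
    using ideal_I unfolding ideal_type_algebra_iff by blast+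
  have binomial_in_I: "Poly_Mapping.single u 1 - Poly_Mapping.single v 1 \<in> I \<longleftrightarrow>
    vertex_weight edge u = vertex_weight edge v" for u v
    using toric_hom_single_diff[of u v edge] I_closed(1)
    by (cases "u = v") (simp_all add: I_def toric_ideal_def)

  have nf_binomial: "nf (t + u) = nf (t + v)"
    if u: "mdeg u = 2" and v: "mdeg v = 2" and uv: "vertex_weight edge u = vertex_weight edge v" for t u v
  proof (cases "u = v")
    case False
    obtain a c where ac: "u = Poly_Mapping.single a 1 + Poly_Mapping.single c 1"
      using u by (rule exponents_mdeg_2)
    obtain b d where bd: "v = Poly_Mapping.single b 1 + Poly_Mapping.single d 1"
      using v by (rule exponents_mdeg_2)
    have abcd: "consecutive_edges edge a b c d"
      using consecutive_edges_of_vertex_weight[OF assms(1)] uv False unfolding ac bd by blast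
    define C where "C = {a, b, c, d}"
    have C: "C \<in> four_cycles edge"
      using abcd unfolding C_def four_cycles_def by blast
    then obtain a' b' c' d' where C': "consecutive_edges edge a' b' c' d'" "C = {a', b', c', d'}"
      "Z C = Poly_Mapping.single a' 1 + Poly_Mapping.single c' 1"
      "W C = Poly_Mapping.single b' 1 + Poly_Mapping.single d' 1"
      using cycle by blast
    \<comment> \<open>Both cyclic orderings of \<open>C\<close> have the same opposite pairs, so the
      binomial is that of the rule for \<open>C\<close> up to sign. One rewrite step in either
      direction then joins the two translates.\<close>
    have "(Z C = u \<and> W C = v) \<or> (Z C = v \<and> W C = u)"
      using consecutive_edges_same_cycle[OF abcd C'(1)] C'(2) C_def unfolding C'(3,4) ac bd
      by (auto simp: doubleton_eq_iff add.commute)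
    then show ?thesis
      using nf_rewrite[OF C, of t] by (auto simp: add.commute)
  qed simp

  \<comment> \<open>Generation by quadratic binomials enters here: \<open>nf_binomial\<close> covers
    every generator in \<open>B\<close>, multiplied by any monomial.\<close>
  have push_I: "push_exponents nf f = 0" if "f \<in> I" for f
  proof (rule push_exponents_Idl_binomials)
    show "f \<in> Idl\<^bsub>poly_ring\<^esub> B"
      using that by (simp add: B(2))
    fix b
    assume b: "b \<in> B"
    then obtain u v where uv: "b = Poly_Mapping.single u 1 - Poly_Mapping.single v 1" "mdeg u = 2" "mdeg v = 2"
      using B(1) by (auto simp: quadratic_binomials_def monomials_eq)
    have "b \<in> I"
      unfolding B(2) using b P.genideal_self[of B] by auto
    then show "\<exists>u v. b = Poly_Mapping.single u 1 - Poly_Mapping.single v 1 \<and> (\<forall>t. nf (t + u) = nf (t + v))"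
      using uv nf_binomial binomial_in_I by blast
  qed

  have steps_weight: "vertex_weight edge u = vertex_weight edge v" if "step\<^sup>*\<^sup>* u v" for u v
    using that
  proof (induction rule: rtranclp_induct)
    case (step v v')
    then obtain C t where C: "C \<in> four_cycles edge" "v = Z C + t" "v' = W C + t"
      by (auto elim: step.cases)
    have "vertex_weight edge (Z C) = vertex_weight edge (W C)"
      using cycle[OF C(1)] vertex_weight_consecutive by metis
    then have "vertex_weight edge v = vertex_weight edge v'"
      unfolding C fun_eq_iff vertex_weight_add by simp
    then show ?case
      using step by simp
  qed simp
  \<comment> \<open>Reduction preserves vertex weights, so each monomial is congruent to its normal
    form modulo \<open>I\<close>. Scaling and adding terms gives the claim.\<close>
  have diff_push_in_I: "f - push_exponents nf f \<in> I" for f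
  proof -
    have single_diff: "Poly_Mapping.single u c - Poly_Mapping.single (nf u) c \<in> I" for u and c :: 'k
    proof -
      have "Const c * (Poly_Mapping.single u 1 - Poly_Mapping.single (nf u) 1) \<in> I"
        using steps_weight[OF nf(1)] by (intro I_closed(3)) (simp only: binomial_in_I)
      then show ?thesis
        by (simp add: right_diff_distrib Const_mult_single)
    qed
    have "f \<in> {f. f - push_exponents nf f \<in> I}"
    proof (rule mem_closed_under_terms)
      fix f g
      assume "f \<in> {f. f - push_exponents nf f \<in> I}" "g \<in> {f. f - push_exponents nf f \<in> I}"
      then have "(f - push_exponents nf f) + (g - push_exponents nf g) \<in> I"
        by (intro I_closed(2)) simp_all
      then show "f + g \<in> {f. f - push_exponents nf f \<in> I}"
        by (simp add: push_exponents_add algebra_simps)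
    qed (simp_all add: I_closed(1) single_diff)
    then show ?thesis by simp
  qed

  define U where "U = {u. mdeg u = k \<and> irreducible_exponent u}"
  \<comment> \<open>Divisibility by \<open>z C\<close> means that the rule for \<open>C\<close>
    applies, so standard monomials are the irreducible ones.\<close>
  have "\<not> z C dvd Poly_Mapping.single u 1 \<longleftrightarrow> (\<forall>v. u \<noteq> Z C + v)" if "C \<in> four_cycles edge" for C u
    using that by (simp add: z single_1_dvd_single_1)
  then have standard_eq: "standard_monomials edge z k = (\<lambda>u. Poly_Mapping.single u 1) ` U"
    unfolding standard_monomials_def U_def monomials_eq irreducible_exponent_def by auto

  \<comment> \<open>The normal form map fixes \<open>F\<close> and kills \<open>F - g\<close>, so
    \<open>F\<close> is the normal form of \<open>g\<close>. Its terms would have degree k by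
    \<open>U\<close> and at least k + 1 by \<open>g\<close>, so there are none.\<close>
  have indep: "F = 0" if F: "Poly_Mapping.keys F \<subseteq> U" "g \<in> terms_ge (k + 1)" "F - g \<in> I" for F g
  proof -
    have "push_exponents nf F = (\<Sum>u\<in>Poly_Mapping.keys F. Poly_Mapping.single u (Poly_Mapping.lookup F u))"
      unfolding push_exponents_def using F(1) by (intro sum.cong) (auto simp: U_def nf_irreducible)
    then have "F = push_exponents nf F"
      using poly_mapping_expand[of F] by simp
    also have "\<dots> = push_exponents nf g"
      using push_I[OF F(3)] by (simp add: push_exponents_diff)
    finally have "Poly_Mapping.keys F \<subseteq> nf ` Poly_Mapping.keys g"
      using keys_push_exponents[of nf g] by simp
    then have "Poly_Mapping.keys F \<subseteq> {u. k + 1 \<le> mdeg u}"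
      using F(2) by (auto simp: terms_ge_def mdeg_nf)
    then have "Poly_Mapping.keys F = {}"
      using F(1) by (fastforce simp: U_def)
    then show "F = 0"
      by simp
  qed

  \<comment> \<open>The normal form of f is split into its part \<open>F\<close> of degree k and the
    rest \<open>g\<close>.\<close>
  have gen: "\<exists>F g. Poly_Mapping.keys F \<subseteq> U \<and> g \<in> terms_ge (k + 1) \<and> f - F - g \<in> I" if f: "f \<in> terms_ge k" for f
  proof -
    define h where "h = push_exponents nf f"
    define F where "F = (\<Sum>u\<in>Poly_Mapping.keys h \<inter> U. Poly_Mapping.single u (Poly_Mapping.lookup h u))"
    define g where "g = (\<Sum>u\<in>Poly_Mapping.keys h - U. Poly_Mapping.single u (Poly_Mapping.lookup h u))"
    have "h = F + g"
      unfolding F_def g_def by (subst poly_mapping_expand[of h]) (rule sum.Int_Diff, simp)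
    have "Poly_Mapping.keys F \<subseteq> U"
      using keys_sum[of "\<lambda>u. Poly_Mapping.single u (Poly_Mapping.lookup h u)" "Poly_Mapping.keys h \<inter> U"]
      by (auto simp: F_def split: if_splits)
    moreover have "g \<in> terms_ge (k + 1)"
    proof -
      \<comment> \<open>Such an exponent is irreducible of degree at least k. As it lies outside
        \<open>U\<close>, its degree is not k.\<close>
      have "k + 1 \<le> mdeg u" if u: "u \<in> Poly_Mapping.keys h - U" for u
      proof -
        obtain u' where u': "u = nf u'" "u' \<in> Poly_Mapping.keys f"
          using u keys_push_exponents[of nf f] unfolding h_def by blast
        then have "k \<le> mdeg u" "irreducible_exponent u"
          using f nf(2) by (auto simp: terms_ge_def mdeg_nf)
        then show ?thesis
          using u by (auto simp: U_def)
      qed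
      then show ?thesis
        using keys_sum[of "\<lambda>u. Poly_Mapping.single u (Poly_Mapping.lookup h u)" "Poly_Mapping.keys h - U"]
        by (fastforce simp: g_def terms_ge_def split: if_splits)
    qed
    moreover have "f - F - g \<in> I"
      using diff_push_in_I[of f] \<open>h = F + g\<close> by (simp add: h_def algebra_simps)
    ultimately show ?thesis by blast
  qed

  have mdeg_U: "mdeg u = k" if "u \<in> U" for u
    using that by (simp add: U_def)
  show ?thesis
    unfolding standard_eq
  proof (intro conjI)
    show "vectorspace (ring_of_type_algebra :: 'k ring) (toric_graded_piece edge k)"
      by (rule vectorspace_toric_graded_piece)
  qed (rule toric_graded_piece_basis; fact mdeg_U indep gen)+
qed

end
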